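(* Let $\mathcal{S}=(\mathcal{X},\mathcal{X}_0,w,f)$ be a discrete-time stochastic dynamical system, and let $\mathcal{X}_u\subseteq\mathcal{X}$ be a set of unsafe states. Let $k\in\mathbb{N}_{\ge 1}$ and $\lambda_i\ge 0$ for $0\le i<k$. Suppose that functions $\mathcal{B}_i:\mathcal{X}\to\mathbb{R}$, $0\le i<k$, form a $k$-inductive barrier certificate ($k$-BC) for $\mathcal{S}$ with these constants, that is: \begin{align*} &\mathcal{B}_i(x)\ge 0 && \forall x\in\mathcal{X},\ 0\le i<k,\\ &\mathcal{B}_0(x)\le\lambda_0 && \forall x\in\mathcal{X}_0,\\ &\mathcal{B}_i(x)\ge 1 && \forall x\in\mathcal{X}_u,\ 0\le i<k,\\ &\mathbb{E}[\mathcal{B}_i(f^i(x_0,w_i))\mid x_0]\le\lambda_i && \forall x_0\in\mathcal{X}_0,\ 1\le i<k,\\ &\mathbb{E}[\mathcal{B}_i(f^k(x,w_k))\mid x]\le\mathcal{B}_i(x) && \forall x\in\mathcal{X}\setminus\mathcal{X}_u,\ 0\le i<k. \end{align*} Then for every initial state $x_0\in\mathcal{X}_0$, the solution process $\mathbf{x}_{x_0}$ starting from $x_0$ satisfies $$\mathbb{P}\{\mathbf{x}_{x_0}(t)\notin\mathcal{X}_u,\ \forall t\in\mathbb{N}\}\ \ge\ 1-\sum_{i=0}^{k-1}\lambda_i.$$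
   Context: A discrete-time stochastic dynamical system is a tuple $\mathcal{S}=(\mathcal{X},\mathcal{X}_0,w,f)$ where $\mathcal{X}\subseteq\mathbb{R}^n$ is a Borel space (the state set), $\mathcal{X}_0\subseteq\mathcal{X}$ is the set of initial states, $w=\{w(t):\Omega\to\mathcal{W},\ t\in\mathbb{N}\}$ is a sequence of i.i.d. random variables from a probability space $(\Omega,\mathcal{F},\mathbb{P})$ to a measurable space $(\mathcal{W},\mathcal{F}_w)$, and $f:\mathcal{X}\times\mathcal{W}\to\mathcal{X}$ is a measurable map (so $\mathcal{X}$ is forward invariant). The dynamics is $x(t+1)=f(x(t),w(t))$, $t\in\mathbb{N}$, where $\mathbb{N}$ includes $0$. For $x_0\in\mathcal{X}_0$, $\mathbf{x}_{x_0}=(x(0),x(1),\dots)$ denotes the solution process with $x(0)=x_0$, and $\mathbf{x}_{x_0}(t)=x(t)$. For $i\ge 1$, $f^i:\mathcal{X}\times\mathcal{W}^i\to\mathcal{X}$ is the $i$-fold composition: $f^1(x,a_0)=f(x,a_0)$ and $f^i(x,(a_0,\dots,a_{i-1}))=f(f^{i-1}(x,(a_0,\dots,a_{i-2})),a_{i-1})$ for $i>1$. The symbol $w_i$ denotes a vector of $i$ consecutive noise terms, $w_i(t)=[w(t);\dots;w(t+i-1)]$ (i.e. $i$ i.i.d. copies of the noise), so that $x(t+i)=f^i(x(t),w_i(t))$. For a function $\mathcal{B}$ on $\mathcal{X}$, $\mathbb{E}[\mathcal{B}(f^i(x,w_i))\mid x]$ denotes the expectation over the noise vector $w_i$ with the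 state $x$ fixed. The set $\mathcal{X}_u$ and the functions $\mathcal{B}_i$ are Borel measurable. *)

theory Defs
  imports "HOL-Probability.Probability"
begin

(* A stochastic system (X, X0, w, f).  M is the probability space (Omega, F, P) and N the
   measurable space (W, F_w) in which the noise takes its values.  Forward invariance of X is
   part of the measurability of f. *)
locale stochastic_system = prob_space M
  for M :: "'o measure"
    and N :: "'w measure"
    and X X0 :: "(real ^ 'n) set"
    and w :: "nat \<Rightarrow> 'o \<Rightarrow> 'w"
    and f :: "(real ^ 'n) \<times> 'w \<Rightarrow> real ^ 'n" +
  assumes states_borel: "X \<in> sets borel"
    and init_subset: "X0 \<subseteq> X"
    and noise_indep: "indep_vars (\<lambda>_. N) w UNIV"
    and noise_ident: "\<And>t. distr M N (w t) = distr M N (w 0)"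
    and f_measurable:
      "f \<in> measurable (restrict_space borel X \<Otimes>\<^sub>M N) (restrict_space borel X)"

primrec solution ::
  "('a \<times> 'w \<Rightarrow> 'a) \<Rightarrow> (nat \<Rightarrow> 'o \<Rightarrow> 'w) \<Rightarrow> 'a \<Rightarrow> 'o \<Rightarrow> nat \<Rightarrow> 'a" where
  "solution f w x \<omega> 0 = x"
| "solution f w x \<omega> (Suc t) = f (solution f w x \<omega> t, w t \<omega>)"

(* f^i(x, (a 0, ..., a (i - 1))), extended by f^0(x) = x. *)
primrec iter_map :: "('a \<times> 'w \<Rightarrow> 'a) \<Rightarrow> nat \<Rightarrow> 'a \<Rightarrow> (nat \<Rightarrow> 'w) \<Rightarrow> 'a" where
  "iter_map f 0 x a = x"
| "iter_map f (Suc i) x a = f (iter_map f i x a, a i)"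

(* w_i(t) = [w(t); ...; w(t + i - 1)], as an extensional function on {..<i}. *)
definition noise_vec :: "(nat \<Rightarrow> 'o \<Rightarrow> 'w) \<Rightarrow> nat \<Rightarrow> nat \<Rightarrow> 'o \<Rightarrow> (nat \<Rightarrow> 'w)" where
  "noise_vec w i t \<omega> = (\<lambda>j\<in>{..<i}. w (t + j) \<omega>)"

lemma iter_map_1: "iter_map f 1 x a = f (x, a 0)"
  by simp

lemma iter_map_cong: "(\<And>j. j < i \<Longrightarrow> a j = b j) \<Longrightarrow> iter_map f i x a = iter_map f i x b"
  by (induction i) auto

lemma solution_add:
  "solution f w x \<omega> (t + i) = iter_map f i (solution f w x \<omega> t) (noise_vec w i t \<omega>)"
proof (induction i)
  case (Suc i)
  have "iter_map f i y (noise_vec w (Suc i) t \<omega>) = iter_map f i y (noise_vec w i t \<omega>)" for y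
    by (rule iter_map_cong) (simp add: noise_vec_def)
  moreover have "noise_vec w (Suc i) t \<omega> i = w (t + i) \<omega>"
    by (simp add: noise_vec_def)
  ultimately show ?case
    using Suc by simp
qed simp

(* E[g(f^i(x, w_i)) | x] for a function g that is nonnegative on the state set.  It takes values
   in [0, \<infinity>], since the Bochner integral would be 0 instead of infinite.  The noise is
   i.i.d., so the law of w_i(t) does not depend on t and the window starting at t = 0 is used. *)
definition step_expectation ::
  "'o measure \<Rightarrow> (nat \<Rightarrow> 'o \<Rightarrow> 'w) \<Rightarrow> ('a \<times> 'w \<Rightarrow> 'a) \<Rightarrow> ('a \<Rightarrow> real) \<Rightarrow> nat \<Rightarrow> 'a \<Rightarrow> ennreal" where
  "step_expectation M w f g i x =
     (\<integral>\<^sup>+\<omega>. ennreal (g (iter_map f i x (noise_vec w i 0 \<omega>))) \<partial>M)"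

definition k_inductive_BC ::
  "'o measure \<Rightarrow> 'a set \<Rightarrow> 'a set \<Rightarrow> 'a set \<Rightarrow> (nat \<Rightarrow> 'o \<Rightarrow> 'w) \<Rightarrow> ('a \<times> 'w \<Rightarrow> 'a) \<Rightarrow>
   nat \<Rightarrow> (nat \<Rightarrow> real) \<Rightarrow> (nat \<Rightarrow> 'a \<Rightarrow> real) \<Rightarrow> bool" where
  "k_inductive_BC M X X0 Xu w f k lam B \<longleftrightarrow>
     (\<forall>i<k. \<forall>x\<in>X. 0 \<le> B i x) \<and>
     (\<forall>x\<in>X0. B 0 x \<le> lam 0) \<and>
     (\<forall>i<k. \<forall>x\<in>Xu. 1 \<le> B i x) \<and>
     (\<forall>i. 1 \<le> i \<and> i < k \<longrightarrow>
        (\<forall>x\<in>X0. step_expectation M w f (B i) i x \<le> ennreal (lam i))) \<and>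
     (\<forall>i<k. \<forall>x\<in>X - Xu. step_expectation M w f (B i) k x \<le> ennreal (B i x))"

end

theory Submission
  imports Defs
begin

text \<open>Sample the solution at the times \<open>i, i + k, i + 2k, \<dots>\<close>. Until the sampled process enters
  \<open>Xu\<close>, the values of \<open>B i\<close> along it form a nonnegative supermartingale, because a block of
  \<open>k\<close> noise terms is independent of the past and distributed like the first block. Since
  \<open>B i \<ge> 1\<close> on \<open>Xu\<close>, the sampled process hits \<open>Xu\<close> with probability at most the expectation of
  \<open>B i\<close> at time \<open>i\<close>, hence at most \<open>lam i\<close>. The \<open>k\<close> sampled processes together visit all times,
  and a union bound concludes.\<close>

text \<open>The state at time \<open>j\<close> depends only on the first \<open>j\<close> noise
  terms, so all states up to time \<open>t\<close> can be read off one common noise vector. Events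
  about the past thereby become sets of histories.\<close>

lemma solution_eq_iter_map:
  assumes "j \<le> t"
  shows "solution f w x \<omega> j = iter_map f j x (noise_vec w t 0 \<omega>)"
proof -
  have "solution f w x \<omega> j = iter_map f j x (noise_vec w j 0 \<omega>)"
    using solution_add[of f w x \<omega> 0 j] by simp
  also have "\<dots> = iter_map f j x (noise_vec w t 0 \<omega>)"
    by (rule iter_map_cong) (use assms in \<open>simp add: noise_vec_def\<close>)
  finally show ?thesis .
qed

context stochastic_system
begin

abbreviation (input) "S \<equiv> restrict_space borel X"

section \<open>Measurability of the dynamics in the state and the noise\<close>

lemma noise_measurable [measurable]: "w t \<in> measurable M N"
  using noise_indep by (simp add: indep_vars_def2)

lemma noise_vec_measurable [measurable]:
  "noise_vec w i t \<in> measurable M (PiM {..<i} (\<lambda>_. N))"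
  unfolding noise_vec_def[abs_def] by measurable

text \<open>The index set \<open>I\<close> may exceed \<open>{..<i}\<close>, so that an early state
  can be viewed as a function of a longer noise history.\<close>

lemma iter_map_measurable:
  assumes "{..<i} \<subseteq> I"
  shows "(\<lambda>(x, a). iter_map f i x a) \<in> measurable (S \<Otimes>\<^sub>M PiM I (\<lambda>_. N)) S"
  using assms
proof (induction i)
  case 0
  show ?case by (simp add: case_prod_beta)
next
  case (Suc i)
  have [measurable]: "(\<lambda>z. iter_map f i (fst z) (snd z)) \<in> measurable (S \<Otimes>\<^sub>M PiM I (\<lambda>_. N)) S"
    using Suc.IH Suc.prems by (auto simp: case_prod_beta lessThan_Suc)
  have [measurable]: "(\<lambda>z. snd z i) \<in> measurable (S \<Otimes>\<^sub>M PiM I (\<lambda>_. N)) N"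
    using Suc.prems by (intro measurable_compose[OF measurable_snd] measurable_component_singleton) auto
  note f_measurable [measurable]
  show ?case
    by (simp add: case_prod_beta)
qed

lemma iter_map_measurable_noise:
  assumes "{..<i} \<subseteq> I" "x \<in> X"
  shows "iter_map f i x \<in> measurable (PiM I (\<lambda>_. N)) S"
  using measurable_compose[OF measurable_Pair1' iter_map_measurable[OF assms(1)], of x] assms(2)
  by (simp add: space_restrict_space)

lemma solution_measurable [measurable]:
  assumes "x \<in> X"
  shows "(\<lambda>\<omega>. solution f w x \<omega> t) \<in> measurable M S"
  unfolding solution_eq_iter_map[OF order_refl]
  by (rule measurable_compose[OF noise_vec_measurable iter_map_measurable_noise[OF order_refl assms]])

section \<open>Law and independence of noise blocks\<close>

text \<open>The whole noise path has an infinite product law with equal factors, and reindexing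
  along the injective shift by \<open>t\<close> keeps the factors. The right-hand side is free of
  \<open>t\<close>, so all windows of length \<open>k\<close> have the same law.\<close>

lemma distr_noise_vec:
  "distr M (PiM {..<k} (\<lambda>_. N)) (noise_vec w k t) = PiM {..<k} (\<lambda>_. distr M N (w 0))"
proof -
  let ?D = "distr M N (w 0)"
  let ?shift = "\<lambda>a. \<lambda>j\<in>{..<k}. a (t + j)"
  have shift: "?shift \<in> measurable (PiM UNIV (\<lambda>_. N)) (PiM {..<k} (\<lambda>_. N))"
    by (auto intro!: measurable_restrict measurable_component_singleton)
  have path: "(\<lambda>\<omega> i. w i \<omega>) \<in> measurable M (PiM UNIV (\<lambda>_. N))"
    by (rule measurable_PiM_single') (auto intro: measurable_space[OF noise_measurable])
  have "distr M (PiM UNIV (\<lambda>_. N)) (\<lambda>\<omega> i. w i \<omega>) = PiM UNIV (\<lambda>i. distr M N (w i))"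
    using noise_indep by (subst (asm) indep_vars_iff_distr_eq_PiM) (auto simp: restrict_UNIV)
  also have "(\<lambda>i. distr M N (w i)) = (\<lambda>_. ?D)"
    using noise_ident by blast
  finally have D: "distr M (PiM UNIV (\<lambda>_. N)) (\<lambda>\<omega> i. w i \<omega>) = PiM UNIV (\<lambda>_. ?D)" .
  have "distr M (PiM {..<k} (\<lambda>_. N)) (noise_vec w k t)
      = distr (distr M (PiM UNIV (\<lambda>_. N)) (\<lambda>\<omega> i. w i \<omega>)) (PiM {..<k} (\<lambda>_. N)) ?shift"
    by (subst distr_distr[OF shift path]) (simp add: comp_def noise_vec_def[abs_def])
  also have "\<dots> = distr (PiM UNIV (\<lambda>_. ?D)) (PiM {..<k} (\<lambda>_. ?D)) ?shift"
    unfolding D by (intro distr_cong sets_PiM_cong) auto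
  also have "\<dots> = PiM {..<k} (\<lambda>_. ?D)"
    using distr_PiM_reindex[of UNIV "\<lambda>_. ?D" "\<lambda>j. t + j" "{..<k}"]
    by (simp add: prob_space_distr inj_on_def)
  finally show ?thesis .
qed

text \<open>The two vectors use the disjoint index blocks \<open>{..<t}\<close> and
  \<open>{t..<t+k}\<close>; the second is then reindexed to start at 0.\<close>

lemma indep_noise_vec:
  "indep_var (PiM {..<t} (\<lambda>_. N)) (noise_vec w t 0) (PiM {..<k} (\<lambda>_. N)) (noise_vec w k t)"
proof -
  let ?shift = "\<lambda>a. \<lambda>j\<in>{..<k}. a (t + j)"
  have "indep_var (PiM {..<t} (\<lambda>_. N)) (\<lambda>\<omega>. restrict (\<lambda>j. w j \<omega>) {..<t})
      (PiM {t..<t+k} (\<lambda>_. N)) (\<lambda>\<omega>. restrict (\<lambda>j. w j \<omega>) {t..<t+k})"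
    by (rule indep_var_restrict[OF noise_indep]) auto
  from indep_var_compose[OF this, of id _ ?shift "PiM {..<k} (\<lambda>_. N)"]
  have "indep_var (PiM {..<t} (\<lambda>_. N)) (id \<circ> (\<lambda>\<omega>. restrict (\<lambda>j. w j \<omega>) {..<t}))
      (PiM {..<k} (\<lambda>_. N)) (?shift \<circ> (\<lambda>\<omega>. restrict (\<lambda>j. w j \<omega>) {t..<t+k}))"
    by (simp add: measurable_restrict measurable_component_singleton)
  moreover have "id \<circ> (\<lambda>\<omega>. restrict (\<lambda>j. w j \<omega>) {..<t}) = noise_vec w t 0"
    by (auto simp: noise_vec_def fun_eq_iff)
  moreover have "?shift \<circ> (\<lambda>\<omega>. restrict (\<lambda>j. w j \<omega>) {t..<t+k}) = noise_vec w k t"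
    by (auto simp: noise_vec_def fun_eq_iff restrict_def)
  ultimately show ?thesis by simp
qed

text \<open>By independence the joint law is a product, so Tonelli applies, and stationarity moves
  the window from \<open>t\<close> to 0, where \<open>step_expectation\<close> uses it. This stands
  in for conditioning on the past.\<close>

lemma nn_integral_history_window:
  assumes F [measurable]: "F \<in> borel_measurable (PiM {..<t} (\<lambda>_. N) \<Otimes>\<^sub>M PiM {..<k} (\<lambda>_. N))"
  shows "(\<integral>\<^sup>+\<omega>. F (noise_vec w t 0 \<omega>, noise_vec w k t \<omega>) \<partial>M)
    = (\<integral>\<^sup>+\<omega>. \<integral>\<^sup>+\<omega>'. F (noise_vec w t 0 \<omega>, noise_vec w k 0 \<omega>') \<partial>M \<partial>M)"
proof -
  let ?H = "PiM {..<t} (\<lambda>_. N)" and ?K = "PiM {..<k} (\<lambda>_. N)"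
  let ?D = "distr M ?H (noise_vec w t 0)" and ?E = "distr M ?K (noise_vec w k t)"
  have E: "?E = distr M ?K (noise_vec w k 0)"
    by (simp add: distr_noise_vec)
  interpret E: prob_space ?E by (rule prob_space_distr) simp
  have "(\<integral>\<^sup>+\<omega>. F (noise_vec w t 0 \<omega>, noise_vec w k t \<omega>) \<partial>M)
      = (\<integral>\<^sup>+z. F z \<partial>distr M (?H \<Otimes>\<^sub>M ?K) (\<lambda>\<omega>. (noise_vec w t 0 \<omega>, noise_vec w k t \<omega>)))"
    by (subst nn_integral_distr) auto
  also have "\<dots> = (\<integral>\<^sup>+z. F z \<partial>(?D \<Otimes>\<^sub>M ?E))"
    using indep_noise_vec[of t k] by (simp add: indep_var_distribution_eq)
  also have "\<dots> = (\<integral>\<^sup>+h. \<integral>\<^sup>+a. F (h, a) \<partial>?E \<partial>?D)"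
    by (rule E.nn_integral_fst[symmetric]) simp
  also have "\<dots> = (\<integral>\<^sup>+\<omega>. \<integral>\<^sup>+a. F (noise_vec w t 0 \<omega>, a) \<partial>?E \<partial>M)"
    by (subst nn_integral_distr) auto
  also have "\<dots> = (\<integral>\<^sup>+\<omega>. \<integral>\<^sup>+\<omega>'. F (noise_vec w t 0 \<omega>, noise_vec w k 0 \<omega>') \<partial>M \<partial>M)"
    unfolding E
    by (intro nn_integral_cong, subst nn_integral_distr)
       (auto intro!: measurable_compose[OF measurable_Pair1' F]
          measurable_space[OF noise_vec_measurable])
  finally show ?thesis .
qed

section \<open>Supermartingale estimate and hitting probability\<close>

text \<open>The supermartingale inequality over one block of \<open>k\<close> steps, tested on a
  past event. That event is given by a set \<open>A\<close> of histories, so its indicator involves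
  only the past and factors out of the integral over the fresh noise.\<close>

lemma nn_integral_solution_step_le:
  fixes b :: "real ^ 'n \<Rightarrow> real"
  assumes "x \<in> X"
    and b [measurable]: "b \<in> borel_measurable S"
    and A [measurable]: "A \<in> sets (PiM {..<t} (\<lambda>_. N))"
    and safe: "\<And>\<omega>. noise_vec w t 0 \<omega> \<in> A \<Longrightarrow> solution f w x \<omega> t \<notin> Xu"
    and step: "\<And>y. y \<in> X - Xu \<Longrightarrow> step_expectation M w f b k y \<le> ennreal (b y)"
  shows "(\<integral>\<^sup>+\<omega>. ennreal (b (solution f w x \<omega> (t + k))) * indicator A (noise_vec w t 0 \<omega>) \<partial>M)
    \<le> (\<integral>\<^sup>+\<omega>. ennreal (b (solution f w x \<omega> t)) * indicator A (noise_vec w t 0 \<omega>) \<partial>M)"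
proof -
  let ?F = "\<lambda>(h, a). ennreal (b (iter_map f k (iter_map f t x h) a)) * indicator A h"
  note [measurable] = iter_map_measurable_noise[OF order_refl \<open>x \<in> X\<close>, of t]
  have [measurable]: "(\<lambda>z. iter_map f k (iter_map f t x (fst z)) (snd z))
      \<in> measurable (PiM {..<t} (\<lambda>_. N) \<Otimes>\<^sub>M PiM {..<k} (\<lambda>_. N)) S"
    using measurable_compose[OF _ iter_map_measurable[OF order_refl, of k],
        of "\<lambda>z. (iter_map f t x (fst z), snd z)"]
    by simp
  have F: "?F \<in> borel_measurable (PiM {..<t} (\<lambda>_. N) \<Otimes>\<^sub>M PiM {..<k} (\<lambda>_. N))"
    unfolding case_prod_beta by measurable
  have "(\<integral>\<^sup>+\<omega>. ennreal (b (solution f w x \<omega> (t + k))) * indicator A (noise_vec w t 0 \<omega>) \<partial>M)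
      = (\<integral>\<^sup>+\<omega>. ?F (noise_vec w t 0 \<omega>, noise_vec w k t \<omega>) \<partial>M)"
    unfolding solution_add by (simp add: solution_eq_iter_map[of t t])
  also have "\<dots> = (\<integral>\<^sup>+\<omega>. \<integral>\<^sup>+\<omega>'. ?F (noise_vec w t 0 \<omega>, noise_vec w k 0 \<omega>') \<partial>M \<partial>M)"
    by (rule nn_integral_history_window[OF F])
  also have "\<dots> \<le> (\<integral>\<^sup>+\<omega>. ennreal (b (solution f w x \<omega> t)) * indicator A (noise_vec w t 0 \<omega>) \<partial>M)"
  \<comment> \<open>For a history in \<open>A\<close> the current state lies in
    \<open>X - Xu\<close>, where \<open>step\<close> applies; otherwise both sides vanish.\<close>
  proof (rule nn_integral_mono)
    fix \<omega> assume "\<omega> \<in> space M"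
    then have "solution f w x \<omega> t \<in> X"
      using measurable_space[OF solution_measurable[OF \<open>x \<in> X\<close>]] by (simp add: space_restrict_space)
    then show "(\<integral>\<^sup>+\<omega>'. ?F (noise_vec w t 0 \<omega>, noise_vec w k 0 \<omega>') \<partial>M)
        \<le> ennreal (b (solution f w x \<omega> t)) * indicator A (noise_vec w t 0 \<omega>)"
      using step[of "solution f w x \<omega> t"] safe[of \<omega>]
      by (auto simp: step_expectation_def solution_eq_iter_map[OF order_refl] split: split_indicator)
  qed
  finally show ?thesis .
qed

text \<open>A maximal inequality at level 1 for the process sampled every \<open>k\<close> steps and
  stopped on entering \<open>Xu\<close>, proved by direct induction on the number of
  samples.\<close>

lemma emeasure_hit_le:
  fixes b :: "real ^ 'n \<Rightarrow> real"
  assumes "x \<in> X" and [measurable]: "Xu \<in> sets borel"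
    and b [measurable]: "b \<in> borel_measurable S"
    and unsafe: "\<And>y. y \<in> Xu \<Longrightarrow> 1 \<le> b y"
    and step: "\<And>y. y \<in> X - Xu \<Longrightarrow> step_expectation M w f b k y \<le> ennreal (b y)"
  shows "emeasure M {\<omega>\<in>space M. \<exists>m. solution f w x \<omega> (i + m * k) \<in> Xu}
    \<le> step_expectation M w f b i x"
proof -
  define y where "y m \<omega> = solution f w x \<omega> (i + m * k)" for m \<omega>
  \<comment> \<open>Only samples strictly before \<open>m\<close> count, so \<open>H 0\<close> is
    empty and the induction starts from the expectation alone.\<close>
  define H where "H m = {\<omega>\<in>space M. \<exists>s<m. y s \<omega> \<in> Xu}" for m
  have [measurable]: "y m \<in> measurable M S" for m
    unfolding y_def[abs_def] using \<open>x \<in> X\<close> by measurable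
  have [measurable]: "y m \<in> borel_measurable M" for m
    using measurable_restrict_space2_iff[of "y m" M borel X] by simp
  have [measurable]: "H m \<in> sets M" for m
    unfolding H_def by measurable
  \<comment> \<open>The probability of having already hit plus the expectation of \<open>b\<close>
    over the surviving paths does not increase with \<open>m\<close>.\<close>
  have bound: "emeasure M (H m) + (\<integral>\<^sup>+\<omega>. ennreal (b (y m \<omega>)) * indicator (space M - H m) \<omega> \<partial>M)
      \<le> step_expectation M w f b i x" for m
  proof (induction m)
    case 0
    have "(\<integral>\<^sup>+\<omega>. ennreal (b (y 0 \<omega>)) * indicator (space M) \<omega> \<partial>M) = step_expectation M w f b i x"
      unfolding step_expectation_def y_def
      by (rule nn_integral_cong) (simp add: solution_eq_iter_map[of i i])
    then show ?case by (simp add: H_def)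
  next
    case (Suc m)
    let ?t = "i + m * k"
    let ?P = "PiM {..<?t} (\<lambda>_. N)"
    \<comment> \<open>The complement of \<open>H (Suc m)\<close> in terms of histories. It includes
      sample \<open>m\<close>, so the state from which the next block starts is safe.\<close>
    define A where "A = {h\<in>space ?P. \<forall>s\<le>m. iter_map f (i + s * k) x h \<notin> Xu}"
    have "iter_map f (i + s * k) x \<in> borel_measurable ?P" if "s \<le> m" for s
      using iter_map_measurable_noise[of "i + s * k" "{..<?t}" x] that \<open>x \<in> X\<close>
      by (auto simp: measurable_restrict_space2_iff)
    then have A: "A \<in> sets ?P"
      unfolding A_def by measurable
    have A_iff: "noise_vec w ?t 0 \<omega> \<in> A \<longleftrightarrow> (\<forall>s\<le>m. y s \<omega> \<notin> Xu)" if "\<omega> \<in> space M" for \<omega>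
    proof -
      have "y s \<omega> = iter_map f (i + s * k) x (noise_vec w ?t 0 \<omega>)" if "s \<le> m" for s
        unfolding y_def using that by (intro solution_eq_iter_map) simp
      then show ?thesis
        using measurable_space[OF noise_vec_measurable that] by (auto simp: A_def)
    qed
    have HSuc: "H (Suc m) = H m \<union> {\<omega>\<in>space M - H m. y m \<omega> \<in> Xu}"
      by (auto simp: H_def less_Suc_eq)
    have "emeasure M (H (Suc m)) = emeasure M (H m) + emeasure M {\<omega>\<in>space M - H m. y m \<omega> \<in> Xu}"
      unfolding HSuc by (rule plus_emeasure[symmetric]) auto
    also have "emeasure M {\<omega>\<in>space M - H m. y m \<omega> \<in> Xu}
        = (\<integral>\<^sup>+\<omega>. indicator {\<omega>\<in>space M - H m. y m \<omega> \<in> Xu} \<omega> \<partial>M)"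
      by (rule nn_integral_indicator[symmetric]) simp
    \<comment> \<open>The paths that hit at sample \<open>m\<close> carry \<open>b\<close>-value at
      least 1, which pays for their probability.\<close>
    also have "\<dots> \<le> (\<integral>\<^sup>+\<omega>. ennreal (b (y m \<omega>)) * indicator {\<omega>\<in>space M - H m. y m \<omega> \<in> Xu} \<omega> \<partial>M)"
      by (rule nn_integral_mono) (auto simp: unsafe split: split_indicator)
    finally have 1: "emeasure M (H (Suc m)) \<le> emeasure M (H m) +
        (\<integral>\<^sup>+\<omega>. ennreal (b (y m \<omega>)) * indicator {\<omega>\<in>space M - H m. y m \<omega> \<in> Xu} \<omega> \<partial>M)"
      by (simp add: add_left_mono)
    have ind: "indicator (space M - H (Suc m)) \<omega> = (indicator A (noise_vec w ?t 0 \<omega>) :: ennreal)"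
      if "\<omega> \<in> space M" for \<omega>
      using A_iff[OF that] that by (auto simp: H_def less_Suc_eq_le split: split_indicator)
    have "(\<integral>\<^sup>+\<omega>. ennreal (b (y (Suc m) \<omega>)) * indicator (space M - H (Suc m)) \<omega> \<partial>M)
        = (\<integral>\<^sup>+\<omega>. ennreal (b (solution f w x \<omega> (?t + k))) * indicator A (noise_vec w ?t 0 \<omega>) \<partial>M)"
      by (rule nn_integral_cong) (simp add: ind y_def ac_simps)
    also have "\<dots> \<le> (\<integral>\<^sup>+\<omega>. ennreal (b (solution f w x \<omega> ?t)) * indicator A (noise_vec w ?t 0 \<omega>) \<partial>M)"
      by (rule nn_integral_solution_step_le[OF assms(1) b A _ step])
         (auto simp: A_def solution_eq_iter_map[of ?t ?t])
    also have "\<dots> = (\<integral>\<^sup>+\<omega>. ennreal (b (y m \<omega>)) * indicator (space M - H (Suc m)) \<omega> \<partial>M)"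
      by (rule nn_integral_cong) (simp add: ind y_def)
    finally have 2: "(\<integral>\<^sup>+\<omega>. ennreal (b (y (Suc m) \<omega>)) * indicator (space M - H (Suc m)) \<omega> \<partial>M)
        \<le> (\<integral>\<^sup>+\<omega>. ennreal (b (y m \<omega>)) * indicator (space M - H (Suc m)) \<omega> \<partial>M)" .
    \<comment> \<open>The survivors of \<open>H m\<close> split into those hitting at sample
      \<open>m\<close> and those still safe, so the bounds \<open>1\<close> and \<open>2\<close> add
      up to the previous value.\<close>
    have "(\<integral>\<^sup>+\<omega>. ennreal (b (y m \<omega>)) * indicator {\<omega>\<in>space M - H m. y m \<omega> \<in> Xu} \<omega> \<partial>M)
        + (\<integral>\<^sup>+\<omega>. ennreal (b (y m \<omega>)) * indicator (space M - H (Suc m)) \<omega> \<partial>M)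
        = (\<integral>\<^sup>+\<omega>. ennreal (b (y m \<omega>)) * indicator (space M - H m) \<omega> \<partial>M)"
      by (subst nn_integral_add[symmetric])
         (auto intro!: nn_integral_cong simp: HSuc split: split_indicator)
    with add_mono[OF 1 2] Suc.IH show ?case
      by (simp add: add.assoc)
  qed
  \<comment> \<open>Continuity from below passes from finitely many samples to all of them.\<close>
  have "emeasure M (\<Union>m. H m) = (SUP m. emeasure M (H m))"
    by (rule SUP_emeasure_incseq[symmetric])
       (auto simp: incseq_def H_def intro: order_less_le_trans)
  also have "\<dots> \<le> step_expectation M w f b i x"
    using order_trans[OF le_iff_add[THEN iffD2] bound] by (blast intro: SUP_least)
  also have "(\<Union>m. H m) = {\<omega>\<in>space M. \<exists>m. solution f w x \<omega> (i + m * k) \<in> Xu}"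
    by (auto simp: H_def y_def)
  finally show ?thesis .
qed

end

theorem mainTheorem2:
  fixes M :: "'o measure"
    and N :: "'w measure"
    and X X0 Xu :: "(real ^ 'n) set"
    and w :: "nat \<Rightarrow> 'o \<Rightarrow> 'w"
    and f :: "(real ^ 'n) \<times> 'w \<Rightarrow> real ^ 'n"
    and k :: nat
    and lam :: "nat \<Rightarrow> real"
    and B :: "nat \<Rightarrow> real ^ 'n \<Rightarrow> real"
  assumes "stochastic_system M N X X0 w f"
    and "Xu \<subseteq> X" and "Xu \<in> sets borel"
    and "k \<ge> 1"
    and "\<And>i. i < k \<Longrightarrow> lam i \<ge> 0"
    and "\<And>i. i < k \<Longrightarrow> B i \<in> borel_measurable (restrict_space borel X)"
    and "k_inductive_BC M X X0 Xu w f k lam B"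
  shows "\<forall>x0\<in>X0. \<P>(\<omega> in M. \<forall>t. solution f w x0 \<omega> t \<notin> Xu) \<ge> 1 - (\<Sum>i<k. lam i)"
proof
  fix x0 assume "x0 \<in> X0"
  interpret stochastic_system M N X X0 w f by fact
  have "x0 \<in> X" using \<open>x0 \<in> X0\<close> init_subset by auto
  note [measurable] = \<open>Xu \<in> sets borel\<close>
  have [measurable]: "(\<lambda>\<omega>. solution f w x0 \<omega> t) \<in> borel_measurable M" for t
    using solution_measurable[OF \<open>x0 \<in> X\<close>, of t] by (simp add: measurable_restrict_space2_iff)
  define U where "U i = {\<omega>\<in>space M. \<exists>m. solution f w x0 \<omega> (i + m * k) \<in> Xu}" for i
  have [measurable]: "U i \<in> sets M" for i
    unfolding U_def by measurable
  have "prob (U i) \<le> lam i" if "i < k" for i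
  proof -
    have "emeasure M (U i) \<le> step_expectation M w f (B i) i x0"
      unfolding U_def using assms that
      by (intro emeasure_hit_le[OF \<open>x0 \<in> X\<close>]) (auto simp: k_inductive_BC_def)
    also have "\<dots> \<le> ennreal (lam i)"
    \<comment> \<open>For \<open>i = 0\<close> no noise is used: the expectation is the constant
      \<open>B 0 x0\<close>, bounded by the condition on initial states.\<close>
    proof (cases i)
      case 0
      then show ?thesis
        using assms(7) \<open>x0 \<in> X0\<close>
        by (simp add: step_expectation_def emeasure_space_1 k_inductive_BC_def ennreal_leI)
    next
      case (Suc _)
      then show ?thesis
        using assms(7) \<open>x0 \<in> X0\<close> that by (simp add: k_inductive_BC_def)
    qed
    finally show ?thesis
      using assms(5)[OF that] by (simp add: emeasure_eq_measure)
  qed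
  then have "prob (\<Union>i<k. U i) \<le> (\<Sum>i<k. lam i)"
    by (intro order_trans[OF finite_measure_subadditive_finite] sum_mono) auto
  moreover have "{\<omega>\<in>space M. \<forall>t. solution f w x0 \<omega> t \<notin> Xu} = space M - (\<Union>i<k. U i)"
  proof -
    \<comment> \<open>Division with remainder: \<open>k \<ge> 1\<close> makes the remainder a valid
      index below \<open>k\<close>.\<close>
    have "\<exists>i<k. \<exists>m. t = i + m * k" for t
      using \<open>k \<ge> 1\<close> by (intro exI[of _ "t mod k"] conjI exI[of _ "t div k"]) auto
    then show ?thesis
      unfolding U_def by auto (metis lessThan_iff)
  qed
  ultimately show "\<P>(\<omega> in M. \<forall>t. solution f w x0 \<omega> t \<notin> Xu) \<ge> 1 - (\<Sum>i<k. lam i)"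
    by (simp add: prob_compl)
qed

end
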